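(* Let $N$ be a positive integer. Then $${}_{5}\phi_{4}\left[\begin{matrix}\frac{q^2}{ad},\,\frac{dq}{a},\,q^{-N},\,q^{1-N},\,q^2\\ \frac{aq^2}{d},\,adq,\,\frac{q^{2-N}}{a^2},\,\frac{q^{3-N}}{a^2}\end{matrix};q^2,q^2\right]$$ $$-\,aq\,\frac{(1-q^{-N})(1-q/(ad))(1-d/a)}{(1-q^{2-N}/a^2)(1-ad)(1-aq/d)}\;{}_{5}\phi_{4}\left[\begin{matrix}\frac{q^3}{ad},\,\frac{dq^2}{a},\,q^{1-N},\,q^{2-N},\,q^2\\ \frac{aq^3}{d},\,adq^2,\,\frac{q^{3-N}}{a^2},\,\frac{q^{4-N}}{a^2}\end{matrix};q^2,q^2\right]$$ $$=\frac{(a,a^2;q)_N}{(qa,a^2/q;q)_N}\;{}_{10}W_{9}\left(a;\sqrt q,-\sqrt q,d,\frac qd,q,a^2q^N,q^{-N};q,-a\right).$$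
   Context: For a base $t$ and $n\ge0$, $(x;t)_n=\prod_{i=0}^{n-1}(1-xt^i)$ and $(x_1,\dots,x_m;t)_n=\prod_{j=1}^m(x_j;t)_n$. The basic hypergeometric series with base $t$ is ${}_{r+1}\phi_r\left[\begin{matrix}a_1,\dots,a_{r+1}\\ b_1,\dots,b_r\end{matrix};t,x\right]=\sum_{n\ge0}\frac{(a_1,\dots,a_{r+1};t)_n}{(t,b_1,\dots,b_r;t)_n}x^n$, where the sum is stopped once an upper parameter of the form $t^{-M}$ ($M\ge 0$ an integer) makes the terms vanish, i.e. it runs over $0\le n\le M$. Further, ${}_{r+1}W_r(a_1;a_4,\dots,a_{r+1};t,x)={}_{r+1}\phi_r\left[\begin{matrix}a_1,\,t\sqrt{a_1},\,-t\sqrt{a_1},\,a_4,\dots,a_{r+1}\\ \sqrt{a_1},\,-\sqrt{a_1},\,a_1t/a_4,\dots,a_1t/a_{r+1}\end{matrix};t,x\right]$. Here $q,a,d$ are nonzero complex numbers such that none of the denominators vanish; square roots are fixed choices. *)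

theory Defs
  imports "HOL-Analysis.Analysis"
begin

definition qpoch :: "complex \<Rightarrow> complex \<Rightarrow> nat \<Rightarrow> complex" where
  "qpoch x t n = (\<Prod>i<n. 1 - x * t ^ i)"

definition qpochs :: "complex list \<Rightarrow> complex \<Rightarrow> nat \<Rightarrow> complex" where
  "qpochs xs t n = (\<Prod>x\<leftarrow>xs. qpoch x t n)"

definition phi_term :: "complex list \<Rightarrow> complex list \<Rightarrow> complex \<Rightarrow> complex \<Rightarrow> nat \<Rightarrow> complex" where
  "phi_term as bs t x n = qpochs as t n / qpochs (t # bs) t n * x ^ n"

definition terminates_at :: "complex list \<Rightarrow> complex \<Rightarrow> nat \<Rightarrow> bool" where
  "terminates_at as t M \<longleftrightarrow> (\<exists>a\<in>set as. a = t powi (- int M))"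

text \<open>
  The series with upper parameters \<open>as\<close> and lower parameters \<open>bs\<close> (one fewer than \<open>as\<close>),
  base \<open>t\<close> and argument \<open>x\<close>. If some upper parameter is \<open>t\<close> to the power \<open>-M\<close>,
  the sum is stopped at the least such \<open>M\<close>, after which all numerators vanish.
\<close>

definition basic_phi :: "complex list \<Rightarrow> complex list \<Rightarrow> complex \<Rightarrow> complex \<Rightarrow> complex" where
  "basic_phi as bs t x =
     (if \<exists>M. terminates_at as t M
      then (\<Sum>n\<le>(LEAST M. terminates_at as t M). phi_term as bs t x n)
      else (\<Sum>n. phi_term as bs t x n))"

text \<open>Here \<open>M\<close> is the index of the last term of the series.\<close>

definition denoms_nonzero :: "complex list \<Rightarrow> complex \<Rightarrow> nat \<Rightarrow> bool" where
  "denoms_nonzero bs t M \<longleftrightarrow> (\<forall>n\<le>M. qpochs (t # bs) t n \<noteq> 0)"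

text \<open>
  In the very-well-poised series, \<open>s\<close> is the chosen square root of the leading parameter \<open>a1\<close>,
  and \<open>as\<close> lists the parameters from the fourth one on.
\<close>

definition vwp_upper :: "complex \<Rightarrow> complex \<Rightarrow> complex list \<Rightarrow> complex \<Rightarrow> complex list" where
  "vwp_upper s a1 as t = [a1, t * s, - t * s] @ as"

definition vwp_lower :: "complex \<Rightarrow> complex \<Rightarrow> complex list \<Rightarrow> complex \<Rightarrow> complex list" where
  "vwp_lower s a1 as t = [s, - s] @ map (\<lambda>c. a1 * t / c) as"

definition vwp_W :: "complex \<Rightarrow> complex \<Rightarrow> complex list \<Rightarrow> complex \<Rightarrow> complex \<Rightarrow> complex" where
  "vwp_W s a1 as t x = basic_phi (vwp_upper s a1 as t) (vwp_lower s a1 as t) t x"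

end

theory Submission
  imports Defs
begin

text \<open>
  Interleaved by parity, the two series on the left form a single sum
  \<open>\<Sum>\<^sub>j (q\<^bsup>-N\<^esup>; q)\<^sub>j / (q\<^bsup>2-N\<^esup>/a\<^sup>2; q)\<^sub>j q\<^sup>j X\<^sub>j\<close>, where \<open>X\<^sub>j / X\<^bsub>j-2\<^esub>\<close> is a ratio of two affine functions of
  \<open>u = d + q/d\<close>. On the right, \<open>d\<close> enters only through
  \<open>\<phi>\<^sub>n = (d, q/d; q)\<^sub>n / (aq/d, ad; q)\<^sub>n\<close>. Reversing the factors depending on \<open>N\<close>, the q-Saalschuetz sum
  expands the coefficient of \<open>\<phi>\<^sub>n\<close> over \<open>j\<close>; after exchanging the summations it remains to see that
  \<open>X\<^sub>j = \<Sum>\<^sub>n K\<^bsub>j,n\<^esub> \<phi>\<^sub>n\<close> for an explicit kernel. That sum satisfies the two-step recurrence of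
  \<open>X\<^sub>j\<close> by creative telescoping.
\<close>

section \<open>Shifted factorials\<close>

lemma qpoch_0 [simp]: "qpoch x t 0 = 1"
  by (simp add: qpoch_def)

lemma qpoch_Suc: "qpoch x t (Suc n) = qpoch x t n * (1 - x * t ^ n)"
  by (simp add: qpoch_def)

lemma qpoch_add: "qpoch x t (m + n) = qpoch x t m * qpoch (x * t ^ m) t n"
  by (induction n) (simp_all add: qpoch_Suc power_add mult.assoc)

lemma qpoch_Suc_shift: "qpoch x t (Suc n) = (1 - x) * qpoch (x * t) t n"
  using qpoch_add[of x t 1 n] by (simp add: qpoch_Suc)

lemma qpoch_double: "qpoch x t (2 * n) = qpoch x (t\<^sup>2) n * qpoch (x * t) (t\<^sup>2) n"
  by (induction n) (simp_all add: qpoch_Suc power_mult mult_ac power2_eq_square power_mult_distrib)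

lemma qpoch_mult_minus: "qpoch x t n * qpoch (- x) t n = qpoch (x\<^sup>2) (t\<^sup>2) n"
proof (induction n)
  case (Suc n)
  have "(1 - x * t ^ n) * (1 + x * t ^ n) = 1 - x\<^sup>2 * (t\<^sup>2) ^ n"
    by (simp add: algebra_simps power2_eq_square power_mult_distrib)
  then show ?case
    using Suc by (simp add: qpoch_Suc mult_ac)
qed simp

lemma qpoch_eq_0_mono:
  assumes "qpoch x t m = 0" "m \<le> n"
  shows "qpoch x t n = 0"
  using assms qpoch_add[of x t m "n - m"] by simp

lemma qpoch_factor_nonzero:
  assumes "qpoch x t n \<noteq> 0" "i < n"
  shows "1 - x * t ^ i \<noteq> 0"
  using assms by (auto simp: qpoch_def)

section \<open>The q-Saalschuetz sum and reversal of products\<close>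

text \<open>Comparing coefficients of z^M in Heine's q-analogue of Euler's transformation of a 2phi1
  gives this convolution form. The proof is of WZ type: the first-order recurrence in
  \<open>M\<close> of the left side, applied to a single summand, produces a difference in
  \<open>i\<close>.\<close>

lemma q_saalschuetz:
  fixes D x y q :: complex
  assumes "q \<noteq> 0" "qpoch q q M \<noteq> 0" "qpoch (D * x * y) q M \<noteq> 0"
  shows "qpoch (D * x) q M * qpoch (D * y) q M / (qpoch q q M * qpoch (D * x * y) q M)
       = (\<Sum>i\<le>M. qpoch D q (M - i) / qpoch q q (M - i) * D ^ i
            * (qpoch x q i * qpoch y q i / (qpoch q q i * qpoch (D * x * y) q i)))"
  using assms(2,3)
proof (induction M)
  case (Suc M)
  define C where "C = D * x * y"
  define F where "F M i = qpoch D q (M - i) / qpoch q q (M - i) * D ^ i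
      * (qpoch x q i * qpoch y q i / (qpoch q q i * qpoch C q i))" for M i
  \<comment> \<open>The certificate of the recurrence. Its value 0 at \<open>i = 0\<close> stands
    for 1/(q;q)_{-1} = 0, which truncated subtraction would miss.\<close>
  define G where "G i = (if i = 0 then 0 else - (q ^ (Suc M - i)) * D ^ i * (qpoch x q i * qpoch y q i)
      / (qpoch q q (i - 1) * qpoch C q (i - 1)) * (qpoch D q (Suc M - i) / qpoch q q (Suc M - i)))" for i
  have nz: "qpoch q q i \<noteq> 0" "qpoch C q i \<noteq> 0" if "i \<le> Suc M" for i
    using Suc.prems qpoch_eq_0_mono[OF _ that] by (auto simp: C_def)
  have nz1: "1 - q * q ^ M \<noteq> 0" "1 - C * q ^ M \<noteq> 0"
    using qpoch_factor_nonzero[OF Suc.prems(1), of M] qpoch_factor_nonzero[OF Suc.prems(2), of M]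
    unfolding C_def by (simp_all only: lessI not_False_eq_True simp_thms)
  have IH: "qpoch (D * x) q M * qpoch (D * y) q M / (qpoch q q M * qpoch C q M) = (\<Sum>i\<le>M. F M i)"
    unfolding C_def F_def by (rule Suc.IH) (use nz[of M] in \<open>simp_all add: C_def\<close>)
  \<comment> \<open>The two coefficients are the denominator and the numerator of the ratio of the
    closed form at \<open>M + 1\<close> to that at \<open>M\<close>.\<close>
  have step: "(1 - q * q ^ M) * (1 - C * q ^ M) * F (Suc M) i
        - (1 - D * x * q ^ M) * (1 - D * y * q ^ M) * F M i = G (Suc i) - G i" if iM: "i \<le> M" for i
  proof -
    obtain k where M: "M = i + k" using le_Suc_ex[OF iM] by blast
    define p K where "p = q ^ i" and "K = q ^ k"
    define Z where "Z = qpoch D q k / qpoch q q (Suc k) * D ^ i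
      * (qpoch x q i * qpoch y q i / (qpoch q q i * qpoch C q i))"
    have k1: "qpoch q q (Suc k) \<noteq> 0" "1 - q * K \<noteq> 0"
      using nz(1)[of "Suc k"] M by (auto simp: K_def qpoch_Suc)
    have F1: "F (Suc M) i = (1 - D * K) * Z"
      using M by (simp add: F_def Z_def K_def qpoch_Suc Suc_diff_le)
    have F2: "F M i = (1 - q * K) * Z"
      using M k1 by (simp add: F_def Z_def K_def qpoch_Suc)
    have G2: "G (Suc i) = - K * D * (1 - x * p) * (1 - y * p) * (1 - q * K) * Z"
      using M k1 by (simp add: G_def Z_def K_def p_def qpoch_Suc mult_ac)
    have G1: "G i = - K * (1 - D * K) * ((1 - p) * (q - C * p)) * Z"
    proof (cases i)
      case 0 then show ?thesis by (simp add: G_def p_def)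
    next
      case (Suc l)
      have "qpoch q q (Suc l) \<noteq> 0" "qpoch C q (Suc l) \<noteq> 0"
        using nz[of "Suc l"] M Suc by auto
      moreover have "q - C * p = q * (1 - C * q ^ l)" using Suc by (simp add: p_def algebra_simps)
      moreover have "Suc M - i = Suc k" using M by simp
      ultimately show ?thesis
        using Suc by (simp add: G_def Z_def K_def p_def qpoch_Suc mult_ac)
    qed
    \<comment> \<open>With the common factor \<open>Z\<close> removed, a polynomial identity in p =
      q^i and K = q^(M-i) remains.\<close>
    have "(1 - q * (p*K)) * (1 - C * (p*K)) * (1 - D * K)
        - (1 - D * x * (p*K)) * (1 - D * y * (p*K)) * (1 - q * K)
      = - K * D * (1 - x * p) * (1 - y * p) * (1 - q * K) + K * (1 - D * K) * ((1 - p) * (q - C * p))"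
      unfolding C_def by algebra
    then have "((1 - q * (p*K)) * (1 - C * (p*K)) * (1 - D * K)
        - (1 - D * x * (p*K)) * (1 - D * y * (p*K)) * (1 - q * K)) * Z
      = (- K * D * (1 - x * p) * (1 - y * p) * (1 - q * K) + K * (1 - D * K) * ((1 - p) * (q - C * p))) * Z"
      by (simp only:)
    moreover have "q ^ M = p * K" by (simp add: M p_def K_def power_add)
    ultimately show ?thesis
      unfolding F1 F2 G1 G2 by (simp add: algebra_simps)
  qed
  have "(\<Sum>i\<le>M. G (Suc i) - G i) = G (Suc M)"
    using sum_lessThan_telescope[of G "Suc M"] unfolding lessThan_Suc_atMost by (simp add: G_def)
  then have "(1 - q * q ^ M) * (1 - C * q ^ M) * (\<Sum>i\<le>M. F (Suc M) i)
        - (1 - D * x * q ^ M) * (1 - D * y * q ^ M) * (\<Sum>i\<le>M. F M i) = G (Suc M)"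
    using step by (simp add: sum_distrib_left flip: sum_subtractf)
  \<comment> \<open>The summand \<open>i = M + 1\<close>, absent at level \<open>M\<close>, cancels
    the boundary value left by telescoping.\<close>
  moreover have "(1 - q * q ^ M) * (1 - C * q ^ M) * F (Suc M) (Suc M) = - G (Suc M)"
    using nz1 by (simp add: F_def G_def qpoch_Suc)
  ultimately have "(1 - q * q ^ M) * (1 - C * q ^ M) * (\<Sum>i\<le>Suc M. F (Suc M) i)
     = (1 - D * x * q ^ M) * (1 - D * y * q ^ M) *
       (qpoch (D * x) q M * qpoch (D * y) q M / (qpoch q q M * qpoch C q M))"
    unfolding IH sum.atMost_Suc distrib_left by simp (simp add: algebra_simps)
  then have "(\<Sum>i\<le>Suc M. F (Suc M) i) = (1 - D * x * q ^ M) * (1 - D * y * q ^ M) *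
       (qpoch (D * x) q M * qpoch (D * y) q M / (qpoch q q M * qpoch C q M))
       / ((1 - q * q ^ M) * (1 - C * q ^ M))"
    using nz1 by (metis (no_types, lifting) mult_eq_0_iff nonzero_mult_div_cancel_left)
  then have "(\<Sum>i\<le>Suc M. F (Suc M) i) = qpoch (D * x) q (Suc M) * qpoch (D * y) q (Suc M)
      / (qpoch q q (Suc M) * qpoch C q (Suc M))"
    by (simp add: qpoch_Suc mult_ac)
  then show ?case by (simp add: F_def C_def)
qed simp

text \<open>Factor by factor, 1 - q^(j-N) over 1 - q^(1+j-N)/y equals (y/q) (1 - q^(N-j)) / (1 - y
  q^(N-j-1)). This moves \<open>N\<close> from the parameters into the index N - j. It is applied
  with y = a^2/q on the left side of the identity and y = a on the right.\<close>

lemma qpoch_reversal: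
  assumes "q \<noteq> 0" "y \<noteq> 0" "qpoch q q N \<noteq> 0" "qpoch y q N \<noteq> 0" "j \<le> N"
  shows "qpoch (1 / q ^ N) q j / qpoch (q / (y * q ^ N)) q j
       = qpoch q q N * qpoch y q (N - j) / (qpoch q q (N - j) * qpoch y q N) * (y / q) ^ j"
  using assms(5)
proof (induction j)
  case (Suc j)
  obtain k where N: "N = Suc (j + k)"
    using Suc.prems less_iff_Suc_add[of j N] by auto
  have k1: "qpoch q q (Suc k) \<noteq> 0" "qpoch y q (Suc k) \<noteq> 0"
    using assms(3,4) qpoch_eq_0_mono[of q q "Suc k" N] qpoch_eq_0_mono[of y q "Suc k" N] N by auto
  have "1 - 1 / q ^ N * q ^ j = (q * q ^ k - 1) / (q * q ^ k)"
    using assms(1) by (simp add: N power_add field_simps)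
  moreover have "1 - q / (y * q ^ N) * q ^ j = (y * q ^ k - 1) / (y * q ^ k)"
    using assms(1,2) by (simp add: N power_add field_simps)
  ultimately have "(1 - 1 / q ^ N * q ^ j) / (1 - q / (y * q ^ N) * q ^ j)
      = (1 - q * q ^ k) / (1 - y * q ^ k) * (y / q)"
    using assms(1,2) k1 by (simp add: qpoch_Suc field_simps)
  then have "qpoch (1 / q ^ N) q (Suc j) / qpoch (q / (y * q ^ N)) q (Suc j)
     = qpoch (1 / q ^ N) q j / qpoch (q / (y * q ^ N)) q j * ((1 - q * q ^ k) / (1 - y * q ^ k) * (y / q))"
    by (simp only: qpoch_Suc times_divide_times_eq[symmetric])
  also have "\<dots> = qpoch q q N * qpoch y q (Suc k) / (qpoch q q (Suc k) * qpoch y q N) * (y / q) ^ j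
       * ((1 - q * q ^ k) / (1 - y * q ^ k) * (y / q))"
    using Suc N by (simp add: Suc_diff_le)
  also have "\<dots> = qpoch q q N * qpoch y q k / (qpoch q q k * qpoch y q N) * (y / q) ^ Suc j"
    using k1 by (simp add: qpoch_Suc mult_ac)
  finally show ?case using N by simp
qed (use assms in simp)

section \<open>Terminating series and splitting by parity\<close>

text \<open>The least terminating index may depend on accidental values of other parameters, for
  instance \<open>d\<close> being a negative power of q. Beyond it all terms vanish, so any
  terminating index gives the same sum.\<close>

lemma basic_phi_terminating:
  assumes "terminates_at as t M" "t \<noteq> 0"
  shows "basic_phi as bs t x = (\<Sum>n\<le>M. phi_term as bs t x n)"
proof -
  define L where "L = (LEAST M. terminates_at as t M)"
  have L: "terminates_at as t L" "L \<le> M"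
    using assms(1) unfolding L_def by (auto intro: LeastI Least_le)
  have "phi_term as bs t x n = 0" if "n \<in> {..M} - {..L}" for n
  proof -
    obtain c where c: "c \<in> set as" "c = t powi (- int L)"
      using L(1) by (auto simp: terminates_at_def)
    have "qpoch c t (Suc L) = 0"
      using c(2) assms(2) by (simp add: qpoch_Suc power_int_minus)
    then have "qpoch c t n = 0"
      using that qpoch_eq_0_mono[of c t "Suc L" n] by auto
    then have "qpochs as t n = 0"
      using c(1) by (force simp: qpochs_def prod_list_zero_iff)
    then show ?thesis by (simp add: phi_term_def)
  qed
  then have "(\<Sum>n\<le>M. phi_term as bs t x n) = (\<Sum>n\<le>L. phi_term as bs t x n)"
    using L(2) by (intro sum.mono_neutral_right) auto
  then show ?thesis using assms(1) by (auto simp: basic_phi_def L_def)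
qed

lemma sum_even_odd:
  fixes g :: "nat \<Rightarrow> 'a::comm_monoid_add"
  assumes "N \<ge> 1"
  shows "(\<Sum>j\<le>N. g j) = (\<Sum>k\<le>N div 2. g (2 * k)) + (\<Sum>k\<le>(N - 1) div 2. g (Suc (2 * k)))"
  using assms
proof (induction N rule: dec_induct)
  case base
  then show ?case by (simp add: add.commute)
next
  case (step N)
  show ?case
  proof (cases "even N")
    case True
    then obtain m where "N = 2 * m" by auto
    moreover have "Suc ((2 * m - Suc 0) div 2) = m" using step \<open>N = 2*m\<close> by presburger
    ultimately show ?thesis using step
      by (cases m) (auto simp: add_ac)
  next
    case False
    then obtain m where "N = Suc (2 * m)" by (auto elim: oddE)
    then show ?thesis using step by (auto simp: add_ac)
  qed
qed

section \<open>The two-step products, the basis functions and the kernel\<close>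

text \<open>
  With \<open>u = d + q/d\<close>, the even-indexed values are the \<open>d\<close>-dependent parts of the terms of the first
  series of the corollary, and the odd-indexed ones those of the second series including its prefactor.
\<close>

fun alt_prod :: "complex \<Rightarrow> complex \<Rightarrow> complex \<Rightarrow> nat \<Rightarrow> complex" where
  "alt_prod q a u 0 = 1"
| "alt_prod q a u (Suc 0) = - a * ((1 + q / a\<^sup>2 - u / a) / (1 + a\<^sup>2 * q - a * u))"
| "alt_prod q a u (Suc (Suc j)) =
     (1 + q ^ (2 * j + 3) / a\<^sup>2 - q ^ (j + 1) * u / a) / (1 + a\<^sup>2 * q ^ (2 * j + 3) - a * q ^ (j + 1) * u)
     * alt_prod q a u j"

text \<open>Written in \<open>u\<close>, so that every factor is a quotient of two affine functions;
  \<open>phi_basis_eq\<close> recovers the product in \<open>d\<close>.\<close>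

definition phi_basis :: "complex \<Rightarrow> complex \<Rightarrow> complex \<Rightarrow> nat \<Rightarrow> complex" where
  "phi_basis q a u n = (\<Prod>i<n. (1 + q ^ (2 * i + 1) - q ^ i * u) / (1 + a\<^sup>2 * q ^ (2 * i + 1) - a * q ^ i * u))"

text \<open>
  Generically \<open>(q; q\<^sup>2)\<^sub>n (q\<^bsup>2n+1\<^esup>; q)\<^bsub>j-n\<^esub> = (q; q)\<^bsub>j+n\<^esub> / (q\<^sup>2; q\<^sup>2)\<^sub>n\<close>; the product form
  remains meaningful when \<open>(q\<^sup>2; q\<^sup>2)\<^sub>n = 0\<close>, which the hypotheses do not exclude (\<open>q = -1\<close>, \<open>N = 1\<close>).
\<close>

definition bailey_kernel :: "complex \<Rightarrow> complex \<Rightarrow> nat \<Rightarrow> nat \<Rightarrow> complex" where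
  "bailey_kernel q a j n = (- 1) ^ n * (1 - a * q ^ (2 * n)) / (1 - a) * qpoch (a\<^sup>2) (q\<^sup>2) n
     * qpoch q (q\<^sup>2) n * qpoch (q ^ (2 * n + 1)) q (j - n) * qpoch (q / a) q (j - n)
     / (qpoch q q (j - n) * qpoch (q * a) q (j + n))"

text \<open>
  Obtained by requiring the identity of \<open>telescoper_step\<close> with a numerator
  independent of \<open>u\<close> in front of \<open>phi_basis\<close> and its last denominator factor: both sides are then linear
  in \<open>u\<close>, and comparing coefficients determines this numerator.
\<close>

definition telescoper :: "complex \<Rightarrow> complex \<Rightarrow> complex \<Rightarrow> nat \<Rightarrow> nat \<Rightarrow> complex" where
  "telescoper q a u j n = (if n = 0 then 0 else
     (- 1) ^ n * qpoch (a\<^sup>2) (q\<^sup>2) n * qpoch q (q\<^sup>2) (n - 1) * qpoch (q ^ (2 * n - 1)) q (j - n)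
     * q ^ (j - n) / q * (1 - q ^ (2 * j - 1)) / a * (qpoch (1 / a) q (j - n) / (1 - 1 / a))
     / (qpoch q q (j - n) * qpoch (q * a) q (j + n - 1))
     * (q + a\<^sup>2 * q ^ (2 * n) - a * q ^ n * u) * phi_basis q a u n)"

section \<open>Creative telescoping in n\<close>

text \<open>The core of \<open>telescoper_step\<close> once common factors are removed; there p =
  q^n and K = q^(j-n-1).\<close>

lemma telescoper_identity:
  fixes q a p K u :: complex
  assumes "a \<noteq> 0"
  shows "(1-a*p^2)*((1-p^2*K)*(1-p^2*q*K)*(1-K/a)*(1-q*K/a)*(1+a^2*p^2*K^2*q-a*p*K*u)
     - (1-q*K)*(1-K)*(1-a*p^2*q*K)*(1-a*p^2*K)*(1+p^2*K^2*q/a^2-p*K*u/a))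
   = (1-a)*(1-p^2*K^2*q)/a*
     (-(1-a^2*p^2)*(1-p^2*K)*K*(1-q*K)*(1+p^2*q-p*u) - (1-p^2)*(1-K/a)*(1-a*p^2*q*K)*K*(q+a^2*p^2-a*p*u))"
proof -
  \<comment> \<open>Replacing 1/a by \<open>b\<close> with ab = 1 makes the claim polynomial, as
    \<open>algebra\<close> requires.\<close>
  define b where "b = 1/a"
  have ab: "a*b = 1" using assms by (simp add: b_def)
  have "(1-a*p^2)*((1-p^2*K)*(1-p^2*q*K)*(1-K*b)*(1-q*K*b)*(1+a^2*p^2*K^2*q-a*p*K*u)
     - (1-q*K)*(1-K)*(1-a*p^2*q*K)*(1-a*p^2*K)*(1+p^2*K^2*q*b^2-p*K*u*b))
   = (1-a)*(1-p^2*K^2*q)*b*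
     (-(1-a^2*p^2)*(1-p^2*K)*K*(1-q*K)*(1+p^2*q-p*u) - (1-p^2)*(1-K*b)*(1-a*p^2*q*K)*K*(q+a^2*p^2-a*p*u))"
    using ab by algebra
  then show ?thesis by (simp add: b_def power_divide)
qed

text \<open>The \<open>u\<close>-dependent numerator in \<open>telescoper\<close> is q times the
  last denominator factor of \<open>phi_basis\<close>, so their product at \<open>n + 1\<close>
  reduces to \<open>phi_basis\<close> at \<open>n\<close>.\<close>

lemma phi_basis_Suc:
  assumes "1 + a\<^sup>2 * q ^ (2 * n + 1) - a * q ^ n * u \<noteq> 0"
  shows "phi_basis q a u (Suc n) * (q + a\<^sup>2 * q ^ (2 * Suc n) - a * q ^ Suc n * u)
      = phi_basis q a u n * (1 + q ^ (2 * n) * q - q ^ n * u) * q"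
proof -
  have "q + a\<^sup>2 * q ^ (2 * Suc n) - a * q ^ Suc n * u = q * (1 + a\<^sup>2 * q ^ (2 * n + 1) - a * q ^ n * u)"
    by (simp add: algebra_simps)
  moreover have "phi_basis q a u (Suc n) = phi_basis q a u n
      * ((1 + q ^ (2 * n) * q - q ^ n * u) / (1 + a\<^sup>2 * q ^ (2 * n + 1) - a * q ^ n * u))"
    unfolding phi_basis_def prod.lessThan_Suc by (simp add: mult_ac)
  ultimately show ?thesis using assms by simp
qed

text \<open>The bulk case n <= j - 2, in which both kernels of the recurrence are present. Writing j
  = n + k + 2 keeps truncated subtraction away.\<close>

lemma telescoper_step:
  assumes nz: "q \<noteq> 0" "a \<noteq> 0" "a \<noteq> 1" "qpoch q q (n + k + 2) \<noteq> 0" "qpoch (q * a) q (2 * (n + k + 2)) \<noteq> 0"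
    "1 + a\<^sup>2 * q ^ (2 * n + 1) - a * q ^ n * u \<noteq> 0"
  defines "j \<equiv> n + k + 2"
  shows "(1 + a\<^sup>2 * q ^ (2 * j - 1) - a * q ^ (j - 1) * u) * (bailey_kernel q a j n * phi_basis q a u n)
       - (1 + q ^ (2 * j - 1) / a\<^sup>2 - q ^ (j - 1) * u / a) * (bailey_kernel q a (n + k) n * phi_basis q a u n)
       = telescoper q a u j (Suc n) - telescoper q a u j n"
proof -
  define p K where "p = q ^ n" and "K = q ^ Suc k"
  have qK: "qpoch q q (Suc (Suc k)) \<noteq> 0"
    using nz(4) qpoch_eq_0_mono[of q q "Suc (Suc k)" "n + k + 2"] by auto
  then have qK1: "qpoch q q k \<noteq> 0" "1 - K \<noteq> 0" "1 - q * K \<noteq> 0"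
    by (auto simp: qpoch_Suc K_def)
  have "qpoch (q * a) q (Suc (Suc (2 * n + k))) \<noteq> 0"
    using nz(5) qpoch_eq_0_mono[of "q * a" q "Suc (Suc (2 * n + k))" "2 * (n + k + 2)"] by auto
  moreover have "1 - q * a * q ^ (2 * n + k) = 1 - a * p\<^sup>2 * K"
      "1 - q * a * q ^ Suc (2 * n + k) = 1 - a * p\<^sup>2 * q * K"
    by (simp_all add: p_def K_def power_add power_mult power2_eq_square power_mult_distrib mult_ac)
  ultimately have aK: "qpoch (q * a) q (2 * n + k) \<noteq> 0" "1 - a * p\<^sup>2 * K \<noteq> 0" "1 - a * p\<^sup>2 * q * K \<noteq> 0"
    unfolding qpoch_Suc mult_eq_0_iff by metis+
  define Q where "Q = qpoch (q * a) q (2 * n + k)"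
  have Q1: "qpoch (q * a) q (Suc (2 * n + k)) = Q * (1 - a * p\<^sup>2 * K)"
    and Q2: "qpoch (q * a) q (Suc (Suc (2 * n + k))) = Q * (1 - a * p\<^sup>2 * K) * (1 - a * p\<^sup>2 * q * K)"
    by (simp_all add: qpoch_Suc Q_def p_def K_def power_add power_mult power2_eq_square power_mult_distrib mult_ac)
  define V where "V = qpoch q q k"
  have V: "qpoch q q (Suc k) = V * (1 - K)" "qpoch q q (Suc (Suc k)) = V * (1 - K) * (1 - q * K)"
    by (simp_all add: qpoch_Suc V_def K_def)
  define U where "U = qpoch (q ^ (2 * n + 1)) q k"
  have U: "qpoch (q ^ (2 * n + 1)) q (Suc k) = U * (1 - p\<^sup>2 * K)"
      "qpoch (q ^ (2 * n + 1)) q (Suc (Suc k)) = U * (1 - p\<^sup>2 * K) * (1 - p\<^sup>2 * q * K)"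
    by (simp_all add: qpoch_Suc U_def K_def p_def power_add power_mult power2_eq_square power_mult_distrib mult_ac)
  define B where "B = qpoch (q / a) q k"
  have B: "qpoch (q / a) q (Suc k) = B * (1 - K / a)"
      "qpoch (q / a) q (Suc (Suc k)) = B * (1 - K / a) * (1 - q * K / a)"
    by (simp_all add: qpoch_Suc B_def K_def)
  have a1: "1 - 1 / a \<noteq> 0" using nz by simp
  \<comment> \<open>The quotient (1/a;q)_{j-n} / (1 - 1/a) in \<open>telescoper\<close> equals
    (q/a;q)_{j-n-1}, hence is also a multiple of \<open>B\<close>.\<close>
  have B': "qpoch (1 / a) q (Suc k) = (1 - 1 / a) * B"
      "qpoch (1 / a) q (Suc (Suc k)) = (1 - 1 / a) * (B * (1 - K / a))"
    using B(1) by (simp_all add: qpoch_Suc_shift[of "1 / a"] B_def)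
  \<comment> \<open>The shortest numerator products over the longest denominator products: each of
    the four terms is then \<open>Z\<close> times a cofactor polynomial in \<open>p\<close>,
    \<open>K\<close>, \<open>q\<close> and \<open>u\<close>.\<close>
  define Z where "Z = (- 1) ^ n * qpoch (a\<^sup>2) (q\<^sup>2) n * qpoch q (q\<^sup>2) n * U * B * phi_basis q a u n
     / (V * (1 - K) * (1 - q * K) * (Q * (1 - a * p\<^sup>2 * K) * (1 - a * p\<^sup>2 * q * K)))"
  have p2: "q ^ (2 * n) = p\<^sup>2" by (simp add: p_def power_mult[symmetric] mult.commute)
  have K1: "bailey_kernel q a j n * phi_basis q a u n = (1 - a * p\<^sup>2) / (1 - a) * ((1 - p\<^sup>2 * K) * (1 - p\<^sup>2 * q * K)
      * (1 - K / a) * (1 - q * K / a)) * Z"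
  proof -
    have e: "j - n = Suc (Suc k)" "j + n = Suc (Suc (2 * n + k))" by (simp_all add: j_def)
    show ?thesis unfolding bailey_kernel_def e U B V Q2 p2 Z_def by (simp add: mult_ac)
  qed
  have K2: "bailey_kernel q a (n + k) n * phi_basis q a u n = (1 - a * p\<^sup>2) / (1 - a) * ((1 - q * K) * (1 - K)
      * (1 - a * p\<^sup>2 * q * K) * (1 - a * p\<^sup>2 * K)) * Z"
  proof -
    have e: "n + k - n = k" "n + k + n = 2 * n + k" by simp_all
    have "Q \<noteq> 0" "V \<noteq> 0" using aK qK1 by (simp_all add: Q_def V_def)
    then show ?thesis unfolding bailey_kernel_def e U_def[symmetric] B_def[symmetric] V_def[symmetric] Q_def[symmetric] p2 Z_def
      using aK qK1 by (simp add: mult_ac)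
  qed
  have J: "q ^ (2 * j - 1) = p\<^sup>2 * K\<^sup>2 * q" "q ^ (j - 1) = p * K"
    by (simp_all add: j_def p_def K_def power_add power_mult power2_eq_square power_mult_distrib mult_ac)
  have C1: "telescoper q a u j (Suc n) = - ((1 - a\<^sup>2 * p\<^sup>2) * (1 - p\<^sup>2 * K) * K * (1 - q * K) * (1 + p\<^sup>2 * q - p * u)
      * ((1 - p\<^sup>2 * K\<^sup>2 * q) / a) * Z)"
  proof -
    have e: "j - Suc n = Suc k" "j + Suc n - 1 = Suc (Suc (2 * n + k))" "Suc n - 1 = n" "2 * Suc n - 1 = 2 * n + 1"
      by (simp_all add: j_def)
    have f: "phi_basis q a u (Suc n) * (q + a\<^sup>2 * q ^ (2 * Suc n) - a * q ^ Suc n * u)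
        = phi_basis q a u n * (1 + p\<^sup>2 * q - p * u) * q"
      using phi_basis_Suc[OF nz(6)] by (simp only: p_def[symmetric] p2)
    have g: "qpoch (a\<^sup>2) (q\<^sup>2) (Suc n) = qpoch (a\<^sup>2) (q\<^sup>2) n * (1 - a\<^sup>2 * p\<^sup>2)"
      by (simp add: qpoch_Suc p2[symmetric] power_mult)
    have "telescoper q a u j (Suc n) = (- 1) ^ Suc n * (qpoch (a\<^sup>2) (q\<^sup>2) n * (1 - a\<^sup>2 * p\<^sup>2)) * qpoch q (q\<^sup>2) n * (U * (1 - p\<^sup>2 * K))
     * K / q * (1 - p\<^sup>2 * K\<^sup>2 * q) / a * B
     / (V * (1 - K) * (Q * (1 - a * p\<^sup>2 * K) * (1 - a * p\<^sup>2 * q * K)))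
     * (phi_basis q a u (Suc n) * (q + a\<^sup>2 * q ^ (2 * Suc n) - a * q ^ Suc n * u))"
      unfolding telescoper_def e g U B' V Q2 J K_def[symmetric] using a1 by (simp add: mult_ac)
    also have "\<dots> = - ((1 - a\<^sup>2 * p\<^sup>2) * (1 - p\<^sup>2 * K) * K * (1 - q * K) * (1 + p\<^sup>2 * q - p * u)
      * ((1 - p\<^sup>2 * K\<^sup>2 * q) / a) * Z)"
      unfolding f Z_def using nz qK1 by (simp add: mult_ac)
    finally show ?thesis .
  qed
  have C2: "telescoper q a u j n = (1 - p\<^sup>2) * (1 - K / a) * (1 - a * p\<^sup>2 * q * K) * K * (q + a\<^sup>2 * p\<^sup>2 - a * p * u)
      * ((1 - p\<^sup>2 * K\<^sup>2 * q) / a) * Z"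
  proof (cases n)
    \<comment> \<open>The factor 1 - p^2 vanishes, in agreement with the value 0 set in
      \<open>telescoper\<close>.\<close>
    case 0 then show ?thesis by (simp add: telescoper_def p_def)
  next
    case (Suc l)
    have e: "j - n = Suc (Suc k)" "j + n - 1 = Suc (2 * n + k)" "n - 1 = l" "2 * n - 1 = Suc (2 * l)"
      using Suc by (simp_all add: j_def)
    \<comment> \<open>In the longer product the factor 1 - q^(2n-1) completes (q;q^2)_n, and the
      next one is 1 - q^(2n) = 1 - p^2.\<close>
    have r: "qpoch q (q\<^sup>2) l * qpoch (q ^ Suc (2 * l)) q (Suc (Suc k)) = qpoch q (q\<^sup>2) n * (1 - p\<^sup>2) * U"
      using Suc unfolding qpoch_Suc_shift[of "q ^ Suc (2 * l)"] qpoch_Suc_shift[of "q ^ Suc (2 * l) * q"]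
      by (simp add: qpoch_Suc U_def p_def power_mult power2_eq_square power_mult_distrib mult_ac)
    have "telescoper q a u j n = (- 1) ^ n * qpoch (a\<^sup>2) (q\<^sup>2) n * (qpoch q (q\<^sup>2) l * qpoch (q ^ Suc (2 * l)) q (Suc (Suc k)))
     * (K * q) / q * (1 - p\<^sup>2 * K\<^sup>2 * q) / a * (B * (1 - K / a))
     / (V * (1 - K) * (1 - q * K) * (Q * (1 - a * p\<^sup>2 * K)))
     * (q + a\<^sup>2 * p\<^sup>2 - a * p * u) * phi_basis q a u n"
      using Suc nz(1-3) unfolding telescoper_def e B' V Q1 J p2 by (simp add: mult_ac p_def K_def)
    also have "\<dots> = (1 - p\<^sup>2) * (1 - K / a) * (1 - a * p\<^sup>2 * q * K) * K * (q + a\<^sup>2 * p\<^sup>2 - a * p * u)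
      * ((1 - p\<^sup>2 * K\<^sup>2 * q) / a) * Z"
      unfolding r Z_def using nz aK by (simp add: mult_ac)
    finally show ?thesis .
  qed
  have a2: "1 - a \<noteq> 0" using nz by simp
  \<comment> \<open>Multiplying by 1 - a clears the denominator of the kernels and brings both sides
    into the shape of \<open>telescoper_identity\<close>.\<close>
  have lhs: "(1 - a) * (F * (c / (1 - a) * W1 * Z) - E * (c / (1 - a) * W2 * Z)) = (c * (W1 * F - W2 * E)) * Z"
    for F E W1 W2 c
  proof -
    define c' where "c' = c / (1 - a)"
    have "c = c' * (1 - a)" using a2 by (simp add: c'_def)
    then show ?thesis unfolding c'_def[symmetric] by algebra
  qed
  have rhs: "((1 - a) * c / a * (- X * Y * T * R * H - W)) * Z = (1 - a) * (- (X * Y * T * R * H * (c / a) * Z) - W * (c / a) * Z)"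
    for X Y T R H W c by (simp add: algebra_simps)
  have "(1 - a) * ((1+a^2*p^2*K^2*q-a*p*K*u) * (bailey_kernel q a j n * phi_basis q a u n)
       - (1+p^2*K^2*q/a^2-p*K*u/a) * (bailey_kernel q a (n + k) n * phi_basis q a u n))
       = (1-a) * (telescoper q a u j (Suc n) - telescoper q a u j n)"
    unfolding K1 K2 lhs telescoper_identity[OF nz(2)] C1 C2 rhs ..
  then have "(1+a^2*p^2*K^2*q-a*p*K*u) * (bailey_kernel q a j n * phi_basis q a u n)
       - (1+p^2*K^2*q/a^2-p*K*u/a) * (bailey_kernel q a (n + k) n * phi_basis q a u n)
       = telescoper q a u j (Suc n) - telescoper q a u j n"
    using mult_left_cancel[OF a2] by blast
  then show ?thesis unfolding J by (simp only: mult.assoc)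
qed

text \<open>At n = j - 1 the sum for j - 2 has no term, so only one kernel remains. Truncated
  subtraction would not in general make the other kernel 0, hence the separate case.\<close>

lemma telescoper_step_penultimate:
  assumes nz: "q \<noteq> 0" "a \<noteq> 0" "a \<noteq> 1" "qpoch q q (n + 1) \<noteq> 0" "qpoch (q * a) q (2 * (n + 1)) \<noteq> 0"
    "1 + a\<^sup>2 * q ^ (2 * n + 1) - a * q ^ n * u \<noteq> 0" and n: "n \<ge> 1"
  defines "j \<equiv> n + 1"
  shows "(1 + a\<^sup>2 * q ^ (2 * j - 1) - a * q ^ (j - 1) * u) * (bailey_kernel q a j n * phi_basis q a u n)
       = telescoper q a u j (Suc n) - telescoper q a u j n"
proof -
  obtain l where l: "n = Suc l" using n by (cases n) auto
  define p where "p = q ^ n"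
  have p2: "q ^ (2 * n) = p\<^sup>2" by (simp add: p_def power_mult[symmetric] mult.commute)
  have p21: "q ^ (2 * n + 1) = p\<^sup>2 * q" using p2 by simp
  have q1: "1 - q \<noteq> 0" using nz(4) qpoch_eq_0_mono[of q q 1 "n + 1"] by (auto simp: qpoch_Suc)
  have a1: "1 - 1 / a \<noteq> 0" "1 - a \<noteq> 0" using nz by simp_all
  have "qpoch (q * a) q (Suc (2 * n)) \<noteq> 0"
    using nz(5) qpoch_eq_0_mono[of "q * a" q "Suc (2 * n)" "2 * (n + 1)"] by auto
  moreover have "1 - q * a * q ^ (2 * n) = 1 - a * p\<^sup>2 * q"
    using p2 by (simp add: mult_ac)
  ultimately have aK: "qpoch (q * a) q (2 * n) \<noteq> 0" "1 - a * p\<^sup>2 * q \<noteq> 0"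
    unfolding qpoch_Suc mult_eq_0_iff by metis+
  define Q where "Q = qpoch (q * a) q (2 * n)"
  have Q1: "qpoch (q * a) q (Suc (2 * n)) = Q * (1 - a * p\<^sup>2 * q)"
    using p2 by (simp add: qpoch_Suc Q_def mult_ac)
  have one: "qpoch x q 1 = 1 - x" for x by (simp add: qpoch_def)
  define Z where "Z = (- 1) ^ n * qpoch (a\<^sup>2) (q\<^sup>2) n * qpoch q (q\<^sup>2) n * phi_basis q a u n
     / (Q * (1 - a * p\<^sup>2 * q)) * (1 - p\<^sup>2 * q)"
  have K1: "bailey_kernel q a j n * phi_basis q a u n = (1 - a * p\<^sup>2) / (1 - a) * (1 - q / a) / (1 - q) * Z"
  proof -
    have e: "j - n = 1" "j + n = Suc (2 * n)" by (simp_all add: j_def)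
    show ?thesis
      unfolding bailey_kernel_def e one Q1 p2 p21 Z_def by (simp add: mult_ac)
  qed
  \<comment> \<open>Here \<open>j - Suc n\<close> is 0, and (1/a;q)_0 / (1 - 1/a) is the correct
    value of (q/a;q)_{-1}.\<close>
  have C1: "telescoper q a u j (Suc n) = - ((1 - a\<^sup>2 * p\<^sup>2) * (1 + p\<^sup>2 * q - p * u) / (a * (1 - 1 / a)) * Z)"
  proof -
    have e: "j - Suc n = 0" "j + Suc n - 1 = Suc (2 * n)" "Suc n - 1 = n" "2 * j - 1 = 2 * n + 1"
      by (simp_all add: j_def)
    have f: "phi_basis q a u (Suc n) * (q + a\<^sup>2 * q ^ (2 * Suc n) - a * q ^ Suc n * u)
        = phi_basis q a u n * (1 + p\<^sup>2 * q - p * u) * q"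
      using phi_basis_Suc[OF nz(6)] by (simp only: p_def[symmetric] p2)
    have g: "qpoch (a\<^sup>2) (q\<^sup>2) (Suc n) = qpoch (a\<^sup>2) (q\<^sup>2) n * (1 - a\<^sup>2 * p\<^sup>2)"
      by (simp add: qpoch_Suc p2[symmetric] power_mult)
    have "telescoper q a u j (Suc n) = (- 1) ^ Suc n * (qpoch (a\<^sup>2) (q\<^sup>2) n * (1 - a\<^sup>2 * p\<^sup>2)) * qpoch q (q\<^sup>2) n
     / q * (1 - p\<^sup>2 * q) / a / (1 - 1 / a) / (Q * (1 - a * p\<^sup>2 * q))
     * (phi_basis q a u (Suc n) * (q + a\<^sup>2 * q ^ (2 * Suc n) - a * q ^ Suc n * u))"
      unfolding telescoper_def e g Q1 p21 by (simp add: mult_ac)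
    also have "\<dots> = - ((1 - a\<^sup>2 * p\<^sup>2) * (1 + p\<^sup>2 * q - p * u) / (a * (1 - 1 / a)) * Z)"
      unfolding f Z_def using nz by (simp add: mult_ac)
    finally show ?thesis .
  qed
  have C2: "telescoper q a u j n = (1 - a * p\<^sup>2 * q) * (q + a\<^sup>2 * p\<^sup>2 - a * p * u) / (a * (1 - q)) * Z"
  proof -
    have e: "j - n = 1" "j + n - 1 = 2 * n" "n - 1 = l" "2 * n - 1 = Suc (2 * l)" "2 * j - 1 = 2 * n + 1"
      using l by (simp_all add: j_def)
    have r: "qpoch q (q\<^sup>2) l * (1 - q ^ Suc (2 * l)) = qpoch q (q\<^sup>2) n"
      using l by (simp add: qpoch_Suc power_mult)
    have "telescoper q a u j n = (- 1) ^ n * qpoch (a\<^sup>2) (q\<^sup>2) n * (qpoch q (q\<^sup>2) l * (1 - q ^ Suc (2 * l)))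
     * (1 - p\<^sup>2 * q) / a / ((1 - q) * Q) * (q + a\<^sup>2 * p\<^sup>2 - a * p * u) * phi_basis q a u n"
      unfolding telescoper_def e one p2 p21 Q_def p_def[symmetric] using l a1 nz(1) by simp
    also have "\<dots> = (1 - a * p\<^sup>2 * q) * (q + a\<^sup>2 * p\<^sup>2 - a * p * u) / (a * (1 - q)) * Z"
      unfolding r Z_def using nz aK by (simp add: mult_ac)
    finally show ?thesis .
  qed
  have J: "q ^ (2 * j - 1) = p\<^sup>2 * q" "q ^ (j - 1) = p"
    using p2 by (simp_all add: j_def p_def)
  define F H L where "F = 1 + a\<^sup>2 * (p\<^sup>2 * q) - a * p * u" and "H = 1 + p\<^sup>2 * q - p * u"
    and "L = q + a\<^sup>2 * p\<^sup>2 - a * p * u"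
  \<comment> \<open>This is \<open>telescoper_identity\<close> at K = 1, where its second product
    vanishes, with common factors divided out.\<close>
  have id: "(1 - a * p\<^sup>2) * (a - q) * F = a * (1 - q) * (1 - a\<^sup>2 * p\<^sup>2) * H - (1 - a) * (1 - a * p\<^sup>2 * q) * L"
    unfolding F_def H_def L_def by algebra
  have "F * ((1 - a * p\<^sup>2) / (1 - a) * (1 - q / a) / (1 - q))
      = (1 - a * p\<^sup>2) * (a - q) * F / (a * (1 - a) * (1 - q))"
    using nz(2) by (simp add: diff_divide_eq_iff mult_ac)
  also have "\<dots> = (1 - a\<^sup>2 * p\<^sup>2) * H / (1 - a) - (1 - a * p\<^sup>2 * q) * L / (a * (1 - q))"
    unfolding id diff_divide_distrib using a1(2) q1 nz(2) by (simp add: mult_ac)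
  also have "(1 - a\<^sup>2 * p\<^sup>2) * H / (1 - a) = - ((1 - a\<^sup>2 * p\<^sup>2) * H / (a * (1 - 1 / a)))"
  proof -
    have "a * (1 - 1 / a) = - (1 - a)" using nz(2) by (simp add: right_diff_distrib)
    then show ?thesis by (simp only: divide_minus_right minus_minus)
  qed
  finally have "F * ((1 - a * p\<^sup>2) / (1 - a) * (1 - q / a) / (1 - q)) * Z
     = (- ((1 - a\<^sup>2 * p\<^sup>2) * H / (a * (1 - 1 / a))) - (1 - a * p\<^sup>2 * q) * L / (a * (1 - q))) * Z"
    by (simp only:)
  then show ?thesis
    unfolding J K1 C1 C2 F_def[symmetric] H_def[symmetric] L_def[symmetric] left_diff_distrib
    by (simp only: mult_minus_left mult.assoc)
qed

text \<open>The summand n = j closes the telescope, as if the telescoper were 0 at j + 1.\<close>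

lemma telescoper_last:
  assumes "a \<noteq> 0" "a \<noteq> 1" "q \<noteq> 0" "qpoch (q * a) q (2 * j) \<noteq> 0" "j \<ge> 1"
  shows "telescoper q a u j j =
    - ((1 + a\<^sup>2 * q ^ (2 * j - 1) - a * q ^ (j - 1) * u) * (bailey_kernel q a j j * phi_basis q a u j))"
proof -
  obtain l where l: "j = Suc l" using assms(5) by (cases j) auto
  define p where "p = q ^ j"
  have p2: "q ^ (2 * j) = p\<^sup>2" by (simp add: p_def power_mult[symmetric] mult.commute)
  have r: "qpoch q (q\<^sup>2) j = qpoch q (q\<^sup>2) l * (1 - q ^ (2 * j - 1))"
    using l by (simp add: qpoch_Suc power_mult)
  define Q where "Q = qpoch (q * a) q (2 * j - 1)"
  have "2 * j = Suc (2 * j - 1)" using l by simp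
  moreover have pw: "q ^ (2 * j - 1) = q ^ l * q ^ l * q" "q ^ (j - 1) = q ^ l" "p = q ^ l * q"
    using l by (simp_all add: p_def mult_2 power_add)
  then have "1 - q * a * q ^ (2 * j - 1) = 1 - a * p\<^sup>2"
    by (simp add: power2_eq_square mult_ac)
  ultimately have Q: "qpoch (q * a) q (2 * j) = Q * (1 - a * p\<^sup>2)"
    using qpoch_Suc[of "q * a" q "2 * j - 1"] by (metis Q_def)
  then have ap: "1 - a * p\<^sup>2 \<noteq> 0" using assms(4) by auto
  define F where "F = 1 + a\<^sup>2 * q ^ (2 * j - 1) - a * q ^ l * u"
  have f: "q + a\<^sup>2 * p\<^sup>2 - a * p * u = q * F"
    unfolding F_def pw by (simp add: algebra_simps power2_eq_square)
  have e: "j - 1 = l" "j - j = 0" "j + j - 1 = 2 * j - 1" "j + j = 2 * j" using l by simp_all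
  have c: "telescoper q a u j j = (- 1) ^ j * qpoch (a\<^sup>2) (q\<^sup>2) j * qpoch q (q\<^sup>2) j / (a * (1 - 1 / a)) / Q
      * F * phi_basis q a u j"
    unfolding telescoper_def e p2 p_def[symmetric] f r using l assms(3)
    by (simp add: Q_def mult_ac)
  have neg: "a * (1 - 1 / a) = - (1 - a)" using assms(1) by (simp add: right_diff_distrib)
  have k: "bailey_kernel q a j j = (- 1) ^ j * qpoch (a\<^sup>2) (q\<^sup>2) j * qpoch q (q\<^sup>2) j / (1 - a) / Q"
    unfolding bailey_kernel_def e p2 Q using ap by (simp add: mult_ac)
  have "x / - w / v * y * z = - (y * (x / w / v * z))" for x y z v w :: complex by simp
  then show ?thesis unfolding c k neg e F_def[symmetric] by blast
qed

text \<open>Summing the three telescoping cases over n gives F S_j = E S_{j-2} for the sums S_j,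
  which is the recursion of \<open>alt_prod\<close>. The cases j = 0 and j = 1 are computed
  directly.\<close>

lemma bailey_kernel_sum:
  fixes q a u :: complex
  assumes nz: "q \<noteq> 0" "a \<noteq> 0" "a \<noteq> 1"
    and "qpoch q q j \<noteq> 0" "qpoch (q * a) q (2 * j) \<noteq> 0"
    and "\<And>i. i < j \<Longrightarrow> 1 + a\<^sup>2 * q ^ (2 * i + 1) - a * q ^ i * u \<noteq> 0"
  shows "(\<Sum>n\<le>j. bailey_kernel q a j n * phi_basis q a u n) = alt_prod q a u j"
  using assms(4-)
proof (induction j rule: induct_nat_012)
  case 0
  then show ?case using nz by (simp add: bailey_kernel_def phi_basis_def)
next
  case 1
  define F where "F = 1 + a\<^sup>2 * q - a * u"
  have F: "F \<noteq> 0" using 1(3)[of 0] by (simp add: F_def)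
  have q1: "1 - q \<noteq> 0" using 1(1) by (simp add: qpoch_Suc)
  have "qpoch (q * a) q (Suc (Suc 0)) \<noteq> 0" using 1(2) by (simp add: numeral_2_eq_2)
  then have a12: "1 - q * a \<noteq> 0" "1 - q * a * q \<noteq> 0" by (auto simp: qpoch_Suc)
  have k0: "bailey_kernel q a (Suc 0) 0 * phi_basis q a u 0 = (1 - q / a) / (1 - q * a)"
    using nz q1 by (simp add: bailey_kernel_def phi_basis_def qpoch_Suc)
  have "bailey_kernel q a (Suc 0) (Suc 0) = (- 1) * (1 - q * a * q) / (1 - a) * ((1 - a) * (1 + a)) * (1 - q) / ((1 - q * a) * (1 - q * a * q))"
  proof -
    have "1 - a\<^sup>2 = (1 - a) * (1 + a)" "1 - a * q\<^sup>2 = 1 - q * a * q"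
      by (simp_all add: algebra_simps power2_eq_square)
    then show ?thesis by (simp only: bailey_kernel_def) (simp add: qpoch_Suc)
  qed
  also have "\<dots> = - ((1 + a) * (1 - q) / (1 - q * a))"
  proof -
    have "(- 1) * x / y * (y * (1 + a)) * (1 - q) / (z * x) = - ((1 + a) * (1 - q) / z)"
      if "x \<noteq> 0" "y \<noteq> 0" for x y z :: complex using that by simp
    then show ?thesis using a12 nz(3) by (metis eq_iff_diff_eq_0)
  qed
  finally have k1: "bailey_kernel q a (Suc 0) (Suc 0) * phi_basis q a u (Suc 0)
     = - ((1 + a) * (1 - q) / (1 - q * a)) * ((1 + q - u) / F)"
    by (simp add: phi_basis_def F_def)
  have "(1 - q / a) / (1 - q * a) + - ((1 + a) * (1 - q) / (1 - q * a)) * ((1 + q - u) / F)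
      = ((1 - q / a) * F - (1 + a) * (1 - q) * (1 + q - u)) / ((1 - q * a) * F)"
  proof -
    have "X / z + - (Y / z) * (W / F) = (X * F - Y * W) / (z * F)" if "z \<noteq> 0" for X Y W z
      using that F by (simp add: field_simps)
    then show ?thesis using a12(1) by blast
  qed
  \<comment> \<open>The common numerator splits off 1 - qa, which cancels the kernel
    denominator.\<close>
  also have "(1 - q / a) * F - (1 + a) * (1 - q) * (1 + q - u) = (1 - q * a) * (u - a - q / a)"
    using nz(2) by (simp add: F_def field_simps power2_eq_square)
  also have "(1 - q * a) * (u - a - q / a) / ((1 - q * a) * F) = (u - a - q / a) / F"
    using a12 by simp
  also have "u - a - q / a = - a * (1 + q / a\<^sup>2 - u / a)"
    using nz(2) by (simp add: field_simps power2_eq_square)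
  finally show ?case
    unfolding sum.atMost_Suc atMost_0 by (simp add: k0 k1[simplified] F_def)
next
  case (ge2 i)
  define j where "j = Suc (Suc i)"
  define F where "F = 1 + a\<^sup>2 * q ^ (2 * j - 1) - a * q ^ (j - 1) * u"
  define E where "E = 1 + q ^ (2 * j - 1) / a\<^sup>2 - q ^ (j - 1) * u / a"
  define S where "S = (\<lambda>j n. bailey_kernel q a j n * phi_basis q a u n)"
  have F: "F \<noteq> 0" using ge2(5)[of "Suc i"] by (simp add: F_def j_def)
  have q: "qpoch q q m \<noteq> 0" if "m \<le> j" for m
    using ge2(3) qpoch_eq_0_mono[OF _ that, of q q] by (auto simp: j_def)
  have qa: "qpoch (q * a) q m \<noteq> 0" if "m \<le> 2 * j" for m
    using ge2(4) qpoch_eq_0_mono[OF _ that, of "q * a" q] by (auto simp: j_def)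
  have IH: "(\<Sum>n\<le>i. S i n) = alt_prod q a u i"
    unfolding S_def using ge2(5) q qa by (intro ge2(1)) (simp_all add: j_def)
  have c1: "F * S j n - E * S i n = telescoper q a u j (Suc n) - telescoper q a u j n" if "n \<le> i" for n
  proof -
    define k where "k = i - n"
    have i: "i = n + k" "j = n + k + 2" using that by (simp_all add: k_def j_def)
    show ?thesis
      using telescoper_step[OF nz, of n k u] q[of j] qa[of "2 * j"] ge2(5)[of n] that
      unfolding F_def E_def S_def by (simp add: i)
  qed
  have c2: "F * S j (Suc i) = telescoper q a u j j - telescoper q a u j (Suc i)"
    using telescoper_step_penultimate[OF nz, of "Suc i" u] q[of j] qa[of "2 * j"] ge2(5)[of "Suc i"]
    unfolding F_def S_def by (simp add: j_def)
  have c3: "F * S j j = - telescoper q a u j j"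
    using telescoper_last[OF nz(2,3,1), of j u] qa[of "2 * j"] unfolding F_def S_def by (simp add: j_def)
  have "F * (\<Sum>n\<le>i. S j n) - E * alt_prod q a u i = (\<Sum>n\<le>i. telescoper q a u j (Suc n) - telescoper q a u j n)"
    unfolding IH[symmetric] sum_distrib_left sum_subtractf[symmetric] using c1 by simp
  also have "\<dots> = telescoper q a u j (Suc i) - telescoper q a u j 0"
    using sum_lessThan_telescope[of "telescoper q a u j" "Suc i"] unfolding lessThan_Suc_atMost .
  also have "telescoper q a u j 0 = 0" by (simp add: telescoper_def)
  \<comment> \<open>The value left over at j - 1 is absorbed by the summands n = j - 1 and n =
    j.\<close>
  finally have "F * (\<Sum>n\<le>j. S j n) = E * alt_prod q a u i"
    using c2 c3 unfolding j_def sum.atMost_Suc distrib_left by (simp add: algebra_simps)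
  then have "(\<Sum>n\<le>j. S j n) = E / F * alt_prod q a u i"
    using F by (simp add: field_simps)
  moreover have "alt_prod q a u j = E / F * alt_prod q a u i"
    by (simp add: j_def E_def F_def numeral_3_eq_3)
  ultimately show ?case unfolding S_def j_def by simp
qed

section \<open>From \<open>u\<close> back to \<open>d\<close>\<close>

text \<open>Parameters come in pairs containing d and q/d, so each pair of factors is affine in u =
  d + q/d. The choice c = 1 gives the numerators of \<open>phi_basis\<close>, c = a all
  denominators, and c = 1/a the numerators of \<open>alt_prod\<close>.\<close>

lemma conjugate_factors:
  fixes c d q x :: complex
  assumes "d \<noteq> 0"
  shows "(1 - c * d * x) * (1 - c * q / d * x) = 1 + c\<^sup>2 * (q * x\<^sup>2) - c * x * (d + q / d)"
  using assms by (simp add: field_simps power2_eq_square)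

lemma phi_basis_eq:
  assumes "d \<noteq> 0"
  shows "phi_basis q a (d + q / d) n
    = qpoch d q n * qpoch (q / d) q n / (qpoch (a * q / d) q n * qpoch (a * d) q n)"
proof (induction n)
  case (Suc n)
  have "1 + q ^ (2 * n + 1) - q ^ n * (d + q / d) = (1 - d * q ^ n) * (1 - q / d * q ^ n)"
    using conjugate_factors[OF assms, of 1 "q ^ n" q] by (simp add: power_mult[symmetric] mult.commute)
  moreover have "1 + a\<^sup>2 * q ^ (2 * n + 1) - a * q ^ n * (d + q / d) = (1 - a * d * q ^ n) * (1 - a * q / d * q ^ n)"
    using conjugate_factors[OF assms, of a "q ^ n" q] by (simp add: power_mult[symmetric] mult.commute)
  moreover have "phi_basis q a (d + q / d) (Suc n) = phi_basis q a (d + q / d) n *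
     ((1 + q ^ (2 * n + 1) - q ^ n * (d + q / d)) / (1 + a\<^sup>2 * q ^ (2 * n + 1) - a * q ^ n * (d + q / d)))"
    unfolding phi_basis_def prod.lessThan_Suc ..
  ultimately show ?case by (simp only: Suc qpoch_Suc times_divide_times_eq mult_ac)
qed (simp add: phi_basis_def)

lemma alt_prod_step:
  assumes "d \<noteq> 0"
  shows "alt_prod q a (d + q / d) (Suc (Suc j)) =
    (1 - d / a * q ^ Suc j) * (1 - q / (a * d) * q ^ Suc j)
      / ((1 - a * d * q ^ Suc j) * (1 - a * q / d * q ^ Suc j)) * alt_prod q a (d + q / d) j"
proof -
  have e: "q ^ (2 * j + 3) = q * (q ^ (j + 1))\<^sup>2"
  proof -
    have "2 * j + 3 = Suc ((j + 1) * 2)" by simp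
    then show ?thesis by (simp only: power_Suc power_mult)
  qed
  show ?thesis
    using conjugate_factors[OF assms, of a "q ^ (j + 1)" q] conjugate_factors[OF assms, of "1 / a" "q ^ (j + 1)" q]
    unfolding alt_prod.simps e by (simp add: power_divide)
qed

lemma alt_prod_even:
  assumes "d \<noteq> 0"
  shows "alt_prod q a (d + q / d) (2 * k) =
    qpoch (q\<^sup>2 / (a * d)) (q\<^sup>2) k * qpoch (d * q / a) (q\<^sup>2) k
    / (qpoch (a * q\<^sup>2 / d) (q\<^sup>2) k * qpoch (a * d * q) (q\<^sup>2) k)"
proof (induction k)
  case (Suc k)
  have eqs: "d / a * q ^ Suc (2 * k) = d * q / a * (q\<^sup>2) ^ k" "q / (a * d) * q ^ Suc (2 * k) = q\<^sup>2 / (a * d) * (q\<^sup>2) ^ k"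
    "a * d * q ^ Suc (2 * k) = a * d * q * (q\<^sup>2) ^ k" "a * q / d * q ^ Suc (2 * k) = a * q\<^sup>2 / d * (q\<^sup>2) ^ k"
    by (simp_all add: power_mult power2_eq_square)
  show ?case
    unfolding mult_Suc_right add_2_eq_Suc alt_prod_step[OF assms] Suc qpoch_Suc eqs by (simp add: mult_ac)
qed simp

lemma alt_prod_odd:
  assumes "d \<noteq> 0"
  shows "alt_prod q a (d + q / d) (Suc (2 * k)) =
    - a * ((1 - q / (a * d)) * (1 - d / a) / ((1 - a * d) * (1 - a * q / d))) *
    (qpoch (q ^ 3 / (a * d)) (q\<^sup>2) k * qpoch (d * q\<^sup>2 / a) (q\<^sup>2) k
    / (qpoch (a * q ^ 3 / d) (q\<^sup>2) k * qpoch (a * d * q\<^sup>2) (q\<^sup>2) k))"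
proof (induction k)
  case 0
  then show ?case
    using conjugate_factors[OF assms, of a 1 q] conjugate_factors[OF assms, of "1 / a" 1 q]
    by (simp add: power_divide mult_ac)
next
  case (Suc k)
  have eqs: "d / a * q ^ Suc (Suc (2 * k)) = d * q\<^sup>2 / a * (q\<^sup>2) ^ k" "q / (a * d) * q ^ Suc (Suc (2 * k)) = q ^ 3 / (a * d) * (q\<^sup>2) ^ k"
    "a * d * q ^ Suc (Suc (2 * k)) = a * d * q\<^sup>2 * (q\<^sup>2) ^ k" "a * q / d * q ^ Suc (Suc (2 * k)) = a * q ^ 3 / d * (q\<^sup>2) ^ k"
    by (simp_all add: power_mult power2_eq_square power3_eq_cube)
  show ?case
    unfolding mult_Suc_right add_2_eq_Suc alt_prod_step[OF assms] Suc qpoch_Suc eqs by (simp add: mult_ac)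
qed

section \<open>Summation over j and the well-poised side\<close>

text \<open>With j = n + i and (qa;q)_{2n+i} split after 2n factors, this is
  \<open>q_saalschuetz\<close> for D = a^2/q, x = q^(2n+1), y = q/a. The weights in front of the
  kernel are those that reversal produces from the factors depending on \<open>N\<close>.\<close>

lemma sum_bailey_kernel_saalschuetz:
  assumes nz: "q \<noteq> 0" "a \<noteq> 0" "qpoch q q N \<noteq> 0" "qpoch (q * a) q (2 * N) \<noteq> 0" and "n \<le> N"
  shows "(\<Sum>i\<le>N - n. qpoch (a\<^sup>2 / q) q (N - (n + i)) / qpoch q q (N - (n + i)) * (a\<^sup>2 / q) ^ (n + i) * bailey_kernel q a (n + i) n)
    = (a\<^sup>2 / q) ^ n * ((- 1) ^ n * (1 - a * q ^ (2 * n)) / (1 - a) * qpoch (a\<^sup>2) (q\<^sup>2) n * qpoch q (q\<^sup>2) n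
        / qpoch (q * a) q (2 * n))
      * (qpoch (a\<^sup>2 * q ^ (2 * n)) q (N - n) * qpoch a q (N - n)
        / (qpoch q q (N - n) * qpoch (q * a * q ^ (2 * n)) q (N - n)))"
proof -
  define D where "D = a\<^sup>2 / q"
  define x where "x = q ^ (2 * n + 1)"
  define y where "y = q / a"
  have e: "D * x = a\<^sup>2 * q ^ (2 * n)" "D * y = a" "D * x * y = q * a * q ^ (2 * n)"
    using nz by (simp_all add: D_def x_def y_def power2_eq_square)
  have "qpoch (q * a) q (2 * n + (N - n)) \<noteq> 0"
    using nz(4) qpoch_eq_0_mono[of "q * a" q "2 * n + (N - n)" "2 * N"] \<open>n \<le> N\<close> by auto
  then have h: "qpoch (D * x * y) q (N - n) \<noteq> 0" unfolding e(3) qpoch_add by simp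
  have "qpoch q q (N - n) \<noteq> 0" using nz(3) qpoch_eq_0_mono[of q q "N - n" N] by auto
  note S = q_saalschuetz[OF nz(1) this h]
  define c where "c = (- 1) ^ n * (1 - a * q ^ (2 * n)) / (1 - a) * qpoch (a\<^sup>2) (q\<^sup>2) n * qpoch q (q\<^sup>2) n
        / qpoch (q * a) q (2 * n)"
  have t: "qpoch D q (N - (n + i)) / qpoch q q (N - (n + i)) * D ^ (n + i) * bailey_kernel q a (n + i) n
     = D ^ n * c * (qpoch D q (N - n - i) / qpoch q q (N - n - i) * D ^ i
            * (qpoch x q i * qpoch y q i / (qpoch q q i * qpoch (D * x * y) q i)))" for i
  proof -
    have idx: "n + i - n = i" "n + i + n = 2 * n + i" "N - (n + i) = N - n - i" by simp_all
    show ?thesis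
      unfolding e(3) unfolding bailey_kernel_def c_def idx x_def y_def qpoch_add[of "q * a" q "2 * n" i] power_add[of D]
      by (simp add: mult_ac)
  qed
  show ?thesis
    unfolding D_def[symmetric] c_def[symmetric] t sum_distrib_left[symmetric]
    unfolding S[symmetric] unfolding e(3) unfolding e(1,2) ..
qed

text \<open>Factors of opposite sign merge into products in base q^2, which removes the square
  roots. The parameter q has partner aq/q = a, so the products of a and of q cancel between
  numerator and denominator.\<close>

lemma vwp_term:
  assumes nz: "q \<noteq> 0" "a \<noteq> 0" "a \<noteq> 1" "d \<noteq> 0" "qpoch q q n \<noteq> 0" "qpoch a q n \<noteq> 0" "qpoch a (q\<^sup>2) n \<noteq> 0"
    and "r\<^sup>2 = q" "s\<^sup>2 = a"
  shows "phi_term (vwp_upper s a [r, - r, d, q / d, q, a\<^sup>2 * q ^ N, q powi (- int N)] q)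
      (vwp_lower s a [r, - r, d, q / d, q, a\<^sup>2 * q ^ N, q powi (- int N)] q) q (- a) n
    = (1 - a * q ^ (2 * n)) / (1 - a) * (qpoch q (q\<^sup>2) n / qpoch (a\<^sup>2 * q) (q\<^sup>2) n) * phi_basis q a (d + q / d) n
      * (qpoch (a\<^sup>2 * q ^ N) q n / qpoch (q * a * q ^ N) q n)
      * (qpoch (1 / q ^ N) q n / qpoch (q / (a * q ^ N)) q n) * (- a) ^ n"
proof -
  have r: "r \<noteq> 0" using assms by auto
  have v: "a * q / (a\<^sup>2 * q ^ N) = q / (a * q ^ N)" "a * q / (1 / q ^ N) = q * a * q ^ N" "a * q / q = a"
    "q powi (- int N) = 1 / q ^ N" "a * q / (q / d) = a * d" "a * q / r = a * r" "a * q / - r = - (a * r)" "- q * s = - (q * s)"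
    using nz r by (simp_all add: power_int_minus field_simps power2_eq_square flip: assms(8))
  have m: "qpoch s q n * qpoch (- s) q n = qpoch a (q\<^sup>2) n" "qpoch r q n * qpoch (- r) q n = qpoch q (q\<^sup>2) n"
    "qpoch (a * r) q n * qpoch (- (a * r)) q n = qpoch (a\<^sup>2 * q) (q\<^sup>2) n"
    "qpoch (q * s) q n * qpoch (- (q * s)) q n = qpoch (q\<^sup>2 * a) (q\<^sup>2) n"
    by (simp_all add: qpoch_mult_minus assms(8,9) power_mult_distrib)
  \<comment> \<open>Both sides are (a;q^2)_{n+1}, with the first or the last factor split off; this
    yields the very-well-poised factor.\<close>
  have "(1 - a) * qpoch (q\<^sup>2 * a) (q\<^sup>2) n = qpoch a (q\<^sup>2) n * (1 - a * q ^ (2 * n))"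
    using qpoch_Suc[of a "q\<^sup>2" n] qpoch_Suc_shift[of a "q\<^sup>2" n] by (simp add: power_mult[symmetric] mult.commute[of a])
  then have w: "qpoch (q\<^sup>2 * a) (q\<^sup>2) n = qpoch a (q\<^sup>2) n * ((1 - a * q ^ (2 * n)) / (1 - a))"
    using nz(3) by (simp add: field_simps)
  have "phi_term (vwp_upper s a [r, - r, d, q / d, q, a\<^sup>2 * q ^ N, q powi (- int N)] q)
      (vwp_lower s a [r, - r, d, q / d, q, a\<^sup>2 * q ^ N, q powi (- int N)] q) q (- a) n
    = (qpoch a q n * (qpoch (q * s) q n * qpoch (- (q * s)) q n) * (qpoch r q n * qpoch (- r) q n)
       * qpoch d q n * qpoch (q / d) q n * qpoch q q n * qpoch (a\<^sup>2 * q ^ N) q n * qpoch (1 / q ^ N) q n)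
     / (qpoch q q n * (qpoch s q n * qpoch (- s) q n) * (qpoch (a * r) q n * qpoch (- (a * r)) q n)
       * qpoch (a * q / d) q n * qpoch (a * d) q n * qpoch a q n * qpoch (q / (a * q ^ N)) q n * qpoch (q * a * q ^ N) q n)
     * (- a) ^ n"
    unfolding phi_term_def vwp_upper_def vwp_lower_def qpochs_def
    by (simp only: list.map append.simps prod_list.Cons prod_list.Nil v mult_1_right mult.assoc)
  also have "\<dots> = (1 - a * q ^ (2 * n)) / (1 - a) * (qpoch q (q\<^sup>2) n / qpoch (a\<^sup>2 * q) (q\<^sup>2) n) 
      * (qpoch d q n * qpoch (q / d) q n / (qpoch (a * q / d) q n * qpoch (a * d) q n))
      * (qpoch (a\<^sup>2 * q ^ N) q n / qpoch (q * a * q ^ N) q n)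
      * (qpoch (1 / q ^ N) q n / qpoch (q / (a * q ^ N)) q n) * (- a) ^ n"
    unfolding m w using nz(5-7) by (simp add: mult_ac)
  finally show ?thesis unfolding phi_basis_eq[OF nz(4)] .
qed

lemma sum_triangle_shift:
  fixes g :: "nat \<Rightarrow> nat \<Rightarrow> 'a::comm_monoid_add"
  shows "(\<Sum>n\<le>N. \<Sum>i\<le>N - n. g n (n + i)) = (\<Sum>j\<le>N. \<Sum>n\<le>j. g n j)"
proof -
  have "(\<Sum>n\<le>N. \<Sum>i\<le>N - n. g n (n + i)) = (\<Sum>(n, i)\<in>Sigma {..N} (\<lambda>n. {..N - n}). g n (n + i))"
    by (rule sum.Sigma) auto
  also have "Sigma {..N} (\<lambda>n. {..N - n}) = {(n, i). n + i \<le> N}" by auto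
  also have "(\<Sum>(n, i)\<in>{(n, i). n + i \<le> N}. g n (n + i)) = (\<Sum>j\<le>N. \<Sum>n\<le>j. g n (n + (j - n)))"
    by (rule sum.triangle_reindex_eq)
  also have "\<dots> = (\<Sum>j\<le>N. \<Sum>n\<le>j. g n j)" by (intro sum.cong) auto
  finally show ?thesis .
qed

text \<open>The whole identity with the left series merged and \<open>u\<close> a free variable.
  Each term on the right is an inner sum over j by Saalschuetz; after the exchange the inner sums
  over n are evaluated by \<open>bailey_kernel_sum\<close>.\<close>

lemma alt_prod_expansion:
  fixes q a u :: complex
  assumes nz: "q \<noteq> 0" "a \<noteq> 0" "a \<noteq> 1" "qpoch q q N \<noteq> 0" "qpoch (q * a) q (2 * N) \<noteq> 0"
    and a2: "qpoch (a\<^sup>2 / q) q N \<noteq> 0" "qpoch (a\<^sup>2 * q) (q\<^sup>2) N \<noteq> 0" "qpoch a q N \<noteq> 0"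
    and F: "\<And>i. i < N \<Longrightarrow> 1 + a\<^sup>2 * q ^ (2 * i + 1) - a * q ^ i * u \<noteq> 0"
  shows "(\<Sum>j\<le>N. qpoch (1 / q ^ N) q j / qpoch (q\<^sup>2 / (a\<^sup>2 * q ^ N)) q j * q ^ j * alt_prod q a u j)
    = qpoch a q N * qpoch (a\<^sup>2) q N / (qpoch (q * a) q N * qpoch (a\<^sup>2 / q) q N) *
     (\<Sum>n\<le>N. (1 - a * q ^ (2 * n)) / (1 - a) * (qpoch q (q\<^sup>2) n / qpoch (a\<^sup>2 * q) (q\<^sup>2) n) * phi_basis q a u n
      * (qpoch (a\<^sup>2 * q ^ N) q n / qpoch (q * a * q ^ N) q n)
      * (qpoch (1 / q ^ N) q n / qpoch (q / (a * q ^ N)) q n) * (- a) ^ n)"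
proof -
  define y where "y = a\<^sup>2 / q"
  define P where "P = qpoch q q N / qpoch y q N"
  define t where "t j = qpoch y q (N - j) / qpoch q q (N - j) * y ^ j" for j
  have y: "y \<noteq> 0" "q / (y * q ^ N) = q\<^sup>2 / (a\<^sup>2 * q ^ N)" "y / q * q = y"
    using nz by (simp_all add: y_def power2_eq_square)
  have left: "qpoch (1 / q ^ N) q j / qpoch (q\<^sup>2 / (a\<^sup>2 * q ^ N)) q j * q ^ j = P * t j" if "j \<le> N" for j
  proof -
    have "qpoch (1 / q ^ N) q j / qpoch (q\<^sup>2 / (a\<^sup>2 * q ^ N)) q j * q ^ j
       = qpoch q q N * qpoch y q (N - j) / (qpoch q q (N - j) * qpoch y q N) * ((y / q) ^ j * q ^ j)"
      using qpoch_reversal[OF nz(1) y(1) nz(4) a2(1)[folded y_def] that] unfolding y(2) by (simp add: mult.assoc)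
    then show ?thesis unfolding power_mult_distrib[symmetric] y(3) P_def t_def by (simp add: mult_ac)
  qed
  have right: "qpoch a q N * qpoch (a\<^sup>2) q N / (qpoch (q * a) q N * qpoch y q N) *
     ((1 - a * q ^ (2 * n)) / (1 - a) * (qpoch q (q\<^sup>2) n / qpoch (a\<^sup>2 * q) (q\<^sup>2) n) * phi_basis q a u n
      * (qpoch (a\<^sup>2 * q ^ N) q n / qpoch (q * a * q ^ N) q n)
      * (qpoch (1 / q ^ N) q n / qpoch (q / (a * q ^ N)) q n) * (- a) ^ n)
    = (\<Sum>i\<le>N - n. P * (t (n + i) * (bailey_kernel q a (n + i) n * phi_basis q a u n)))" if "n \<le> N" for n
  proof -
    \<comment> \<open>Both sides are (a^2;q)_{N+n}, split after N or after 2n factors, the first 2n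
      being then separated by parity.\<close>
    have A: "qpoch (a\<^sup>2) q N * qpoch (a\<^sup>2 * q ^ N) q n
        = qpoch (a\<^sup>2) (q\<^sup>2) n * qpoch (a\<^sup>2 * q) (q\<^sup>2) n * qpoch (a\<^sup>2 * q ^ (2 * n)) q (N - n)"
      using qpoch_add[of "a\<^sup>2" q N n] qpoch_add[of "a\<^sup>2" q "2 * n" "N - n"] that
      by (simp add: qpoch_double add.commute)
    have B: "qpoch (q * a) q N * qpoch (q * a * q ^ N) q n
        = qpoch (q * a) q (2 * n) * qpoch (q * a * q ^ (2 * n)) q (N - n)"
      using qpoch_add[of "q * a" q N n] qpoch_add[of "q * a" q "2 * n" "N - n"] that
      by (simp add: add.commute)
    have C: "qpoch (1 / q ^ N) q n / qpoch (q / (a * q ^ N)) q n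
       = qpoch q q N * qpoch a q (N - n) / (qpoch q q (N - n) * qpoch a q N) * (a / q) ^ n"
      using qpoch_reversal[OF nz(1,2,4) a2(3) that] .
    \<comment> \<open>The argument -a and the power from reversal combine into the sign of the
      kernel and the power of a^2/q in the Saalschuetz sum.\<close>
    have Y: "(a / q) ^ n * (- a) ^ n = (- 1) ^ n * y ^ n"
      unfolding power_mult_distrib[symmetric] by (simp add: y_def power2_eq_square)
    have z: "qpoch (a\<^sup>2 * q) (q\<^sup>2) n \<noteq> 0" using a2(2) qpoch_eq_0_mono[OF _ that] by blast
    define w where "w = (1 - a * q ^ (2 * n)) / (1 - a) * qpoch q (q\<^sup>2) n * phi_basis q a u n"
    have "qpoch a q N * qpoch (a\<^sup>2) q N / (qpoch (q * a) q N * qpoch y q N) *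
     ((1 - a * q ^ (2 * n)) / (1 - a) * (qpoch q (q\<^sup>2) n / qpoch (a\<^sup>2 * q) (q\<^sup>2) n) * phi_basis q a u n
      * (qpoch (a\<^sup>2 * q ^ N) q n / qpoch (q * a * q ^ N) q n)
      * (qpoch (1 / q ^ N) q n / qpoch (q / (a * q ^ N)) q n) * (- a) ^ n)
     = w * qpoch a q N / qpoch y q N * ((qpoch (a\<^sup>2) q N * qpoch (a\<^sup>2 * q ^ N) q n) / qpoch (a\<^sup>2 * q) (q\<^sup>2) n)
       / (qpoch (q * a) q N * qpoch (q * a * q ^ N) q n)
       * (qpoch q q N * qpoch a q (N - n) / (qpoch q q (N - n) * qpoch a q N)) * ((a / q) ^ n * (- a) ^ n)"
      unfolding C w_def by (simp only: times_divide_times_eq times_divide_eq_left times_divide_eq_right divide_divide_eq_left mult_ac)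
    also have "\<dots> = w * P * (qpoch (a\<^sup>2) (q\<^sup>2) n * qpoch (a\<^sup>2 * q ^ (2 * n)) q (N - n))
       / (qpoch (q * a) q (2 * n) * qpoch (q * a * q ^ (2 * n)) q (N - n))
       * (qpoch a q (N - n) / qpoch q q (N - n)) * ((- 1) ^ n * y ^ n)"
      unfolding A B Y P_def using z a2(3) by (simp add: mult_ac)
    also have "\<dots> = P * phi_basis q a u n * (\<Sum>i\<le>N - n. t (n + i) * bailey_kernel q a (n + i) n)"
      unfolding t_def y_def sum_bailey_kernel_saalschuetz[OF nz(1,2,4,5) that] w_def by (simp add: mult_ac)
    finally show ?thesis unfolding sum_distrib_left by (simp add: mult_ac)
  qed
  have ker: "(\<Sum>n\<le>j. bailey_kernel q a j n * phi_basis q a u n) = alt_prod q a u j" if "j \<le> N" for j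
  proof (rule bailey_kernel_sum[OF nz(1-3)])
    show "qpoch q q j \<noteq> 0" using nz(4) qpoch_eq_0_mono[OF _ that] by blast
    show "qpoch (q * a) q (2 * j) \<noteq> 0" using nz(5) qpoch_eq_0_mono[of "q * a" q "2 * j" "2 * N"] that by auto
  qed (use F that in simp)
  have "(\<Sum>j\<le>N. qpoch (1 / q ^ N) q j / qpoch (q\<^sup>2 / (a\<^sup>2 * q ^ N)) q j * q ^ j * alt_prod q a u j)
     = (\<Sum>j\<le>N. \<Sum>n\<le>j. P * (t j * (bailey_kernel q a j n * phi_basis q a u n)))"
  proof (intro sum.cong refl)
    fix j assume "j \<in> {..N}"
    then have j: "j \<le> N" by simp
    show "qpoch (1 / q ^ N) q j / qpoch (q\<^sup>2 / (a\<^sup>2 * q ^ N)) q j * q ^ j * alt_prod q a u j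
       = (\<Sum>n\<le>j. P * (t j * (bailey_kernel q a j n * phi_basis q a u n)))"
      unfolding left[OF j] ker[OF j, symmetric] sum_distrib_left by (simp only: mult.assoc)
  qed
  also have "\<dots> = (\<Sum>n\<le>N. \<Sum>i\<le>N - n. P * (t (n + i) * (bailey_kernel q a (n + i) n * phi_basis q a u n)))"
    by (rule sum_triangle_shift[symmetric])
  finally show ?thesis
    unfolding y_def[symmetric] sum_distrib_left using right by simp
qed

section \<open>Specialisation to the stated series\<close>

theorem corollary13:
  fixes q a d r s :: complex and N :: nat
  assumes "N \<ge> 1"
    and "q \<noteq> 0" and "a \<noteq> 0" and "d \<noteq> 0"
    and sqrt_q: "r ^ 2 = q" and sqrt_a: "s ^ 2 = a"
    and denoms_phi1: "denoms_nonzero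
      [a * q ^ 2 / d, a * d * q, q powi (2 - int N) / a ^ 2, q powi (3 - int N) / a ^ 2]
      (q ^ 2) (N div 2)"
    and denoms_phi2: "denoms_nonzero
      [a * q ^ 3 / d, a * d * q ^ 2, q powi (3 - int N) / a ^ 2, q powi (4 - int N) / a ^ 2]
      (q ^ 2) ((N - 1) div 2)"
    and denoms_W: "denoms_nonzero
      (vwp_lower s a [r, - r, d, q / d, q, a ^ 2 * q ^ N, q powi (- int N)] q) q N"
    and denom_factor1: "(1 - q powi (2 - int N) / a ^ 2) * (1 - a * d) * (1 - a * q / d) \<noteq> 0"
    and denom_factor2: "qpochs [q * a, a ^ 2 / q] q N \<noteq> 0"
  shows
    "basic_phi
       [q ^ 2 / (a * d), d * q / a, q powi (- int N), q powi (1 - int N), q ^ 2]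
       [a * q ^ 2 / d, a * d * q, q powi (2 - int N) / a ^ 2, q powi (3 - int N) / a ^ 2]
       (q ^ 2) (q ^ 2)
     - a * q * ((1 - q powi (- int N)) * (1 - q / (a * d)) * (1 - d / a)
                / ((1 - q powi (2 - int N) / a ^ 2) * (1 - a * d) * (1 - a * q / d)))
       * basic_phi
           [q ^ 3 / (a * d), d * q ^ 2 / a, q powi (1 - int N), q powi (2 - int N), q ^ 2]
           [a * q ^ 3 / d, a * d * q ^ 2, q powi (3 - int N) / a ^ 2, q powi (4 - int N) / a ^ 2]
           (q ^ 2) (q ^ 2)
     = qpochs [a, a ^ 2] q N / qpochs [q * a, a ^ 2 / q] q N
       * vwp_W s a [r, - r, d, q / d, q, a ^ 2 * q ^ N, q powi (- int N)] q (- a)"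
proof -
  note nz = assms(2-4)
  define u where "u = d + q / d"
  have pw: "q powi (- int N) = 1 / q ^ N" "q powi (1 - int N) = 1 / q ^ N * q"
    "q powi (2 - int N) = q\<^sup>2 / q ^ N" "q powi (3 - int N) = q\<^sup>2 / q ^ N * q" "q powi (4 - int N) = q\<^sup>2 / q ^ N * q * q"
    using nz(1) by (simp_all add: power_int_diff power_int_minus field_simps power2_eq_square power3_eq_cube power4_eq_xxxx)
  define E where "E = 1 / q ^ N"
  define Y where "Y = q\<^sup>2 / (a\<^sup>2 * q ^ N)"
  have Yeq: "q\<^sup>2 / q ^ N / a\<^sup>2 = Y" "q\<^sup>2 / q ^ N * q / a\<^sup>2 = Y * q" "q\<^sup>2 / q ^ N * q * q / a\<^sup>2 = Y * q * q"
    by (simp_all add: Y_def)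
  have v: "vwp_lower s a [r, - r, d, q / d, q, a ^ 2 * q ^ N, q powi (- int N)] q
      = [s, - s, a * r, - (a * r), a * q / d, a * d, a, q / (a * q ^ N), q * a * q ^ N]"
    using nz sqrt_q by (auto simp: vwp_lower_def power_int_minus field_simps power2_eq_square)
  have "qpochs (q # [s, - s, a * r, - (a * r), a * q / d, a * d, a, q / (a * q ^ N), q * a * q ^ N]) q N \<noteq> 0"
    using denoms_W unfolding v denoms_nonzero_def by blast
  then have W: "qpoch q q N \<noteq> 0" "qpoch s q N * qpoch (- s) q N \<noteq> 0" "qpoch (a * r) q N * qpoch (- (a * r)) q N \<noteq> 0"
    "qpoch (a * q / d) q N \<noteq> 0" "qpoch (a * d) q N \<noteq> 0" "qpoch a q N \<noteq> 0" "qpoch (q * a * q ^ N) q N \<noteq> 0"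
    by (simp_all add: qpochs_def)
  \<comment> \<open>The parameter q puts aq/q = a among the lower parameters, and 1 - a is its first
    factor.\<close>
  have a1: "a \<noteq> 1" using qpoch_factor_nonzero[OF W(6), of 0] \<open>N \<ge> 1\<close> by simp
  have d2: "qpoch (q * a) q N \<noteq> 0" "qpoch (a\<^sup>2 / q) q N \<noteq> 0"
    using denom_factor2 by (simp_all add: qpochs_def)
  \<comment> \<open>The second half of the product belongs to the lower parameter a q^(N+1), the
    partner of q^(-N).\<close>
  have qa: "qpoch (q * a) q (2 * N) \<noteq> 0"
    using qpoch_add[of "q * a" q N N] d2(1) W(7) by (simp add: mult_2)
  have s: "qpoch a (q\<^sup>2) N \<noteq> 0" "qpoch (a\<^sup>2 * q) (q\<^sup>2) N \<noteq> 0"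
    using W(2,3) by (simp_all add: qpoch_mult_minus sqrt_q sqrt_a power_mult_distrib)
  have F: "1 + a\<^sup>2 * q ^ (2 * i + 1) - a * q ^ i * u \<noteq> 0" if "i < N" for i
  proof -
    have "1 + a\<^sup>2 * q ^ (2 * i + 1) - a * q ^ i * u = (1 - a * d * q ^ i) * (1 - a * q / d * q ^ i)"
      using conjugate_factors[OF nz(3), of a "q ^ i" q] by (simp add: u_def power_mult[symmetric] mult.commute[of i])
    then show ?thesis
      using qpoch_factor_nonzero[OF W(4) that] qpoch_factor_nonzero[OF W(5) that] by (metis mult_eq_0_iff)
  qed
  have sq: "q\<^sup>2 powi (- int m) = q powi (- (2 * int m))" for m
    using power_int_mult[of q 2 "- int m"] by simp
  define g where "g j = qpoch E q j / qpoch Y q j * q ^ j * alt_prod q a u j" for j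
  have phi1: "basic_phi
       [q ^ 2 / (a * d), d * q / a, q powi (- int N), q powi (1 - int N), q ^ 2]
       [a * q ^ 2 / d, a * d * q, q powi (2 - int N) / a ^ 2, q powi (3 - int N) / a ^ 2]
       (q ^ 2) (q ^ 2) = (\<Sum>k\<le>N div 2. g (2 * k))" (is "basic_phi ?as ?bs _ _ = _")
  proof -
    \<comment> \<open>Whichever of the exponents -N and 1 - N is even gives a power of q^2.\<close>
    have "terminates_at ?as (q\<^sup>2) (N div 2)"
    proof (cases "even N")
      case True
      then have "q powi (- int N) = q\<^sup>2 powi (- int (N div 2))"
        unfolding sq by (auto elim!: evenE)
      then show ?thesis unfolding terminates_at_def by simp
    next
      case False
      then have "q powi (1 - int N) = q\<^sup>2 powi (- int (N div 2))"
        unfolding sq by (auto elim!: oddE)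
      then show ?thesis unfolding terminates_at_def by simp
    qed
    then have "basic_phi ?as ?bs (q\<^sup>2) (q\<^sup>2) = (\<Sum>k\<le>N div 2. phi_term ?as ?bs (q\<^sup>2) (q\<^sup>2) k)"
      using nz(1) by (intro basic_phi_terminating) auto
    also have "\<dots> = (\<Sum>k\<le>N div 2. g (2 * k))"
    proof (intro sum.cong refl)
      fix k assume k: "k \<in> {..N div 2}"
      \<comment> \<open>This lets the upper parameter q^2 cancel the factor (q^2;q^2)_k of the
        denominator.\<close>
      then have "qpoch (q\<^sup>2) (q\<^sup>2) k \<noteq> 0"
        using denoms_phi1 by (auto simp: denoms_nonzero_def qpochs_def)
      then show "phi_term ?as ?bs (q\<^sup>2) (q\<^sup>2) k = g (2 * k)"
        unfolding phi_term_def qpochs_def g_def u_def alt_prod_even[OF nz(3)] qpoch_double pw Yeq E_def[symmetric] power_mult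
        by (simp add: mult_ac)
    qed
    finally show ?thesis .
  qed
  \<comment> \<open>In the prefactor, 1 - q^(-N) and 1 - q^(2-N)/a^2 are the first factors of the
    products of index 2k + 1, q comes from q^(2k+1), and the rest with its sign is
    \<open>alt_prod\<close> at 1.\<close>
  have phi2: "- (a * q * ((1 - q powi (- int N)) * (1 - q / (a * d)) * (1 - d / a)
                / ((1 - q powi (2 - int N) / a ^ 2) * (1 - a * d) * (1 - a * q / d))))
       * basic_phi
           [q ^ 3 / (a * d), d * q ^ 2 / a, q powi (1 - int N), q powi (2 - int N), q ^ 2]
           [a * q ^ 3 / d, a * d * q ^ 2, q powi (3 - int N) / a ^ 2, q powi (4 - int N) / a ^ 2]
           (q ^ 2) (q ^ 2) = (\<Sum>k\<le>(N - 1) div 2. g (Suc (2 * k)))" (is "?pre * basic_phi ?as ?bs _ _ = _")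
  proof -
    have "terminates_at ?as (q\<^sup>2) ((N - 1) div 2)"
    proof (cases "even N")
      case True
      then have "q powi (2 - int N) = q\<^sup>2 powi (- int ((N - 1) div 2))"
        unfolding sq using \<open>N \<ge> 1\<close> by (intro arg_cong[where f = "power_int q"]) presburger
      then show ?thesis unfolding terminates_at_def by simp
    next
      case False
      then have "q powi (1 - int N) = q\<^sup>2 powi (- int ((N - 1) div 2))"
        unfolding sq by (auto elim!: oddE)
      then show ?thesis unfolding terminates_at_def by simp
    qed
    then have "basic_phi ?as ?bs (q\<^sup>2) (q\<^sup>2) = (\<Sum>k\<le>(N - 1) div 2. phi_term ?as ?bs (q\<^sup>2) (q\<^sup>2) k)"
      using nz(1) by (intro basic_phi_terminating) auto
    then have "?pre * basic_phi ?as ?bs (q\<^sup>2) (q\<^sup>2) = (\<Sum>k\<le>(N - 1) div 2. ?pre * phi_term ?as ?bs (q\<^sup>2) (q\<^sup>2) k)"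
      by (simp only: sum_distrib_left)
    also have "\<dots> = (\<Sum>k\<le>(N - 1) div 2. g (Suc (2 * k)))"
    proof (intro sum.cong refl)
      fix k assume k: "k \<in> {..(N - 1) div 2}"
      then have "qpoch (q\<^sup>2) (q\<^sup>2) k \<noteq> 0"
        using denoms_phi2 by (auto simp: denoms_nonzero_def qpochs_def)
      moreover have "E * q * q = q\<^sup>2 / q ^ N" by (simp add: E_def power2_eq_square)
      ultimately show "?pre * phi_term ?as ?bs (q\<^sup>2) (q\<^sup>2) k = g (Suc (2 * k))"
        unfolding phi_term_def qpochs_def g_def u_def alt_prod_odd[OF nz(3)] qpoch_Suc_shift[of E] qpoch_Suc_shift[of Y]
          qpoch_double pw Yeq E_def[symmetric] power_Suc power_mult
        by (simp add: mult_ac)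
    qed
    finally show ?thesis .
  qed
  have W_sum: "vwp_W s a [r, - r, d, q / d, q, a ^ 2 * q ^ N, q powi (- int N)] q (- a)
    = (\<Sum>n\<le>N. (1 - a * q ^ (2 * n)) / (1 - a) * (qpoch q (q\<^sup>2) n / qpoch (a\<^sup>2 * q) (q\<^sup>2) n) * phi_basis q a u n
      * (qpoch (a\<^sup>2 * q ^ N) q n / qpoch (q * a * q ^ N) q n)
      * (qpoch (1 / q ^ N) q n / qpoch (q / (a * q ^ N)) q n) * (- a) ^ n)"
  proof -
    have "terminates_at (vwp_upper s a [r, - r, d, q / d, q, a ^ 2 * q ^ N, q powi (- int N)] q) q N"
      unfolding terminates_at_def vwp_upper_def by simp
    note S = basic_phi_terminating[OF this nz(1)]
    have z: "qpoch q q n \<noteq> 0" "qpoch a q n \<noteq> 0" "qpoch a (q\<^sup>2) n \<noteq> 0" if "n \<le> N" for n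
      using W(1,6) s(1) qpoch_eq_0_mono[OF _ that] by blast+
    show ?thesis unfolding vwp_W_def S u_def
      using vwp_term[OF nz(1,2) a1 nz(3) z sqrt_q sqrt_a] by (intro sum.cong refl) auto
  qed
  have "(\<Sum>k\<le>N div 2. g (2 * k)) + (\<Sum>k\<le>(N - 1) div 2. g (Suc (2 * k))) = (\<Sum>j\<le>N. g j)"
    using sum_even_odd[OF \<open>N \<ge> 1\<close>, of g] by simp
  also have "\<dots> = qpochs [a, a ^ 2] q N / qpochs [q * a, a ^ 2 / q] q N
       * vwp_W s a [r, - r, d, q / d, q, a ^ 2 * q ^ N, q powi (- int N)] q (- a)"
    using alt_prod_expansion[OF nz(1,2) a1 W(1) qa d2(2) s(2) W(6) F]
    unfolding W_sum g_def E_def Y_def by (simp add: qpochs_def)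
  finally show ?thesis
    unfolding phi1[symmetric] phi2[symmetric] by simp
qed

end
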